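(* Let $F(\lambda,\gamma)$ be the optimal free-energy, with $R,D,C$ the corresponding optimal rate, distortion and classification loss, and let $(\lambda,\gamma)$ evolve by the iso-classification process $$\dot\lambda=-\alpha\frac{\partial C}{\partial\gamma}=-\alpha\frac{\partial^2F}{\partial\gamma^2},\qquad\dot\gamma=\alpha\frac{\partial C}{\partial\lambda}=\alpha\frac{\partial^2F}{\partial\lambda\,\partial\gamma},$$ where $\alpha$ is a parameter that scales time. Then $$\dot C=0,$$ $$\dot D=\frac{\partial D}{\partial\lambda}\dot\lambda+\frac{\partial D}{\partial\gamma}\dot\gamma=-\alpha\Big(\frac{\partial^2F}{\partial\lambda^2}\frac{\partial^2F}{\partial\gamma^2}-\Big(\frac{\partial^2F}{\partial\lambda\,\partial\gamma}\Big)^2\Big)=-\alpha\det(\mathrm{Hess}(F)),$$ $$\dot R=\frac{\partial R}{\partial D}\dot D+\frac{\partial R}{\partial C}\dot C=-\lambda\dot D.$$ For $\alpha>0$ one has $\dot D<0$, because $0\succ\mathrm{Hess}(F)$ (a consequence of the concavity of $F$), and also $\dot\lambda>0$. There is a trade-off between rate and distortion: if $\dot D<0$ then $\dot R>0$.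
   Context: The optimal free-energy is $F(\lambda,\gamma)=\min\,(R+\lambda D+\gamma C)$, the minimum being over a fixed family of encoders $e(z|x)$, latent marginals $m(z)$, decoders $d(x|z)$ and classifiers $c(y|z)$, where data $x\sim p(x)$ have deterministic label $y_x$, $z$ is a latent code, and $$R=\mathbb{E}_{x}\Big[\int e(z|x)\log\frac{e(z|x)}{m(z)}dz\Big],\quad D=\mathbb{E}_x\Big[-\int e(z|x)\log d(x|z)\,dz\Big],\quad C=\mathbb{E}_x\Big[-\int e(z|x)\log c(y_x|z)\,dz\Big].$$ At the optimum for $(\lambda,\gamma)$ these satisfy $D=\partial F/\partial\lambda$ and $C=\partial F/\partial\gamma$; the optimal triples form a surface on which $R$ is a function of $(D,C)$ with $\partial R/\partial D=-\lambda$ and $\partial R/\partial C=-\gamma$. $\mathrm{Hess}(F)$ is the $2\times2$ Hessian of $F$ in $(\lambda,\gamma)$, and $0\succ\mathrm{Hess}(F)$ means it is negative definite. A dot denotes $d/dt$.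
   Formalization: Concavity gives only a semidefinite Hessian, so det(Hess F)≠0 is assumed for 0≻Hess(F), Ḋ<0, λ̇>0 and the partials of R(D,C); λ>0 is assumed for "Ḋ<0 implies Ṙ>0", as Ṙ=−λḊ. *)

theory Defs
  imports "HOL-Probability.Probability"
begin

section \<open>Encoders, marginals, decoders, classifiers\<close>

text \<open>
  Data live in the measure space \<open>\<mu>\<close> (the reference measure for the decoder densities) with data
  distribution \<open>p\<close>; codes live in the measure space \<open>\<nu>\<close>, which plays the role of \<open>dz\<close> (Lebesgue
  measure on Euclidean space, or counting measure for discrete codes).
  \<open>enc q z x\<close> is e(z|x), \<open>marg q z\<close> is m(z), \<open>dec q x z\<close> is d(x|z), and \<open>pmf (clf q z) y\<close> is c(y|z).
\<close>

record ('x, 'y, 'z) model =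
  enc :: "'z \<Rightarrow> 'x \<Rightarrow> real"
  marg :: "'z \<Rightarrow> real"
  dec :: "'x \<Rightarrow> 'z \<Rightarrow> real"
  clf :: "'z \<Rightarrow> 'y pmf"

definition rate :: "'x measure \<Rightarrow> 'z measure \<Rightarrow> ('x, 'y, 'z) model \<Rightarrow> real" where
  "rate p \<nu> q = (\<integral>x. (\<integral>z. enc q z x * ln (enc q z x / marg q z) \<partial>\<nu>) \<partial>p)"

definition distortion :: "'x measure \<Rightarrow> 'z measure \<Rightarrow> ('x, 'y, 'z) model \<Rightarrow> real" where
  "distortion p \<nu> q = (\<integral>x. - (\<integral>z. enc q z x * ln (dec q x z) \<partial>\<nu>) \<partial>p)"

definition class_loss ::
  "'x measure \<Rightarrow> 'z measure \<Rightarrow> ('x \<Rightarrow> 'y) \<Rightarrow> ('x, 'y, 'z) model \<Rightarrow> real" where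
  "class_loss p \<nu> lab q = (\<integral>x. - (\<integral>z. enc q z x * ln (pmf (clf q z) (lab x)) \<partial>\<nu>) \<partial>p)"

text \<open>
  In HOL \<open>ln 0 = 0\<close>, \<open>x / 0 = 0\<close> and non-integrable functions have integral \<open>0\<close>. The last four
  conjuncts exclude these degenerate values: they say that rate, distortion and classification
  loss are genuinely finite. For positive multipliers, models violating them have infinite cost
  and would never be minimizers.
\<close>

definition admissible ::
  "'x measure \<Rightarrow> 'x measure \<Rightarrow> 'z measure \<Rightarrow> ('x \<Rightarrow> 'y) \<Rightarrow> ('x, 'y, 'z) model \<Rightarrow> bool" where
  "admissible \<mu> p \<nu> lab q \<longleftrightarrow>
     (\<lambda>(z, x). enc q z x) \<in> borel_measurable (\<nu> \<Otimes>\<^sub>M p) \<and>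
     (\<forall>x\<in>space p. (\<forall>z\<in>space \<nu>. 0 \<le> enc q z x) \<and> has_bochner_integral \<nu> (\<lambda>z. enc q z x) 1) \<and>
     (\<forall>z\<in>space \<nu>. 0 \<le> marg q z) \<and> has_bochner_integral \<nu> (marg q) 1 \<and>
     (\<lambda>(x, z). dec q x z) \<in> borel_measurable (\<mu> \<Otimes>\<^sub>M \<nu>) \<and>
     (\<forall>z\<in>space \<nu>. (\<forall>x\<in>space \<mu>. 0 \<le> dec q x z) \<and> has_bochner_integral \<mu> (\<lambda>x. dec q x z) 1) \<and>
     (\<forall>y. (\<lambda>z. pmf (clf q z) y) \<in> borel_measurable \<nu>) \<and>
     (AE x in p. AE z in \<nu>. 0 < enc q z x \<longrightarrow>
        0 < marg q z \<and> 0 < dec q x z \<and> 0 < pmf (clf q z) (lab x)) \<and>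
     ((AE x in p. integrable \<nu> (\<lambda>z. enc q z x * ln (enc q z x / marg q z))) \<and>
      integrable p (\<lambda>x. \<integral>z. enc q z x * ln (enc q z x / marg q z) \<partial>\<nu>)) \<and>
     ((AE x in p. integrable \<nu> (\<lambda>z. enc q z x * ln (dec q x z))) \<and>
      integrable p (\<lambda>x. \<integral>z. enc q z x * ln (dec q x z) \<partial>\<nu>)) \<and>
     ((AE x in p. integrable \<nu> (\<lambda>z. enc q z x * ln (pmf (clf q z) (lab x)))) \<and>
      integrable p (\<lambda>x. \<integral>z. enc q z x * ln (pmf (clf q z) (lab x)) \<partial>\<nu>))"

section \<open>Optimal free energy and the surface of optimal triples\<close>

definition lagrangian ::
  "'x measure \<Rightarrow> 'z measure \<Rightarrow> ('x \<Rightarrow> 'y) \<Rightarrow> real \<Rightarrow> real \<Rightarrow> ('x, 'y, 'z) model \<Rightarrow> real" where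
  "lagrangian p \<nu> lab l g q = rate p \<nu> q + l * distortion p \<nu> q + g * class_loss p \<nu> lab q"

definition is_optimal ::
  "'x measure \<Rightarrow> 'z measure \<Rightarrow> ('x \<Rightarrow> 'y) \<Rightarrow> ('x, 'y, 'z) model set \<Rightarrow> real \<Rightarrow> real
    \<Rightarrow> ('x, 'y, 'z) model \<Rightarrow> bool" where
  "is_optimal p \<nu> lab Q l g q \<longleftrightarrow>
     q \<in> Q \<and> (\<forall>q'\<in>Q. lagrangian p \<nu> lab l g q \<le> lagrangian p \<nu> lab l g q')"

text \<open>The infimum is a minimum as soon as an optimal model exists.\<close>

definition free_energy ::
  "'x measure \<Rightarrow> 'z measure \<Rightarrow> ('x \<Rightarrow> 'y) \<Rightarrow> ('x, 'y, 'z) model set \<Rightarrow> real \<Rightarrow> real \<Rightarrow> real" where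
  "free_energy p \<nu> lab Q l g = (INF q\<in>Q. lagrangian p \<nu> lab l g q)"

text \<open>
  The rate as a function of (distortion, classification loss) on the surface of optimal triples
  for multipliers in \<open>\<Omega>\<close>.
\<close>

definition surface_rate ::
  "'x measure \<Rightarrow> 'z measure \<Rightarrow> ('x \<Rightarrow> 'y) \<Rightarrow> ('x, 'y, 'z) model set \<Rightarrow> (real \<times> real) set
    \<Rightarrow> real \<Rightarrow> real \<Rightarrow> real" where
  "surface_rate p \<nu> lab Q \<Omega> d c =
     (THE r. \<exists>l g q. (l, g) \<in> \<Omega> \<and> is_optimal p \<nu> lab Q l g q \<and>
        rate p \<nu> q = r \<and> distortion p \<nu> q = d \<and> class_loss p \<nu> lab q = c)"

section \<open>Partial derivatives and the Hessian of functions of two real variables\<close>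

definition pd1 :: "(real \<Rightarrow> real \<Rightarrow> real) \<Rightarrow> real \<Rightarrow> real \<Rightarrow> real" where
  "pd1 f a b = deriv (\<lambda>s. f s b) a"

definition pd2 :: "(real \<Rightarrow> real \<Rightarrow> real) \<Rightarrow> real \<Rightarrow> real \<Rightarrow> real" where
  "pd2 f a b = deriv (\<lambda>s. f a s) b"

definition C1_on :: "(real \<times> real) set \<Rightarrow> (real \<Rightarrow> real \<Rightarrow> real) \<Rightarrow> bool" where
  "C1_on S f \<longleftrightarrow>
     (\<forall>(a, b)\<in>S. (\<lambda>s. f s b) differentiable (at a) \<and> (\<lambda>s. f a s) differentiable (at b)) \<and>
     continuous_on S (\<lambda>(a, b). pd1 f a b) \<and> continuous_on S (\<lambda>(a, b). pd2 f a b)"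

definition C2_on :: "(real \<times> real) set \<Rightarrow> (real \<Rightarrow> real \<Rightarrow> real) \<Rightarrow> bool" where
  "C2_on S f \<longleftrightarrow> C1_on S f \<and> C1_on S (pd1 f) \<and> C1_on S (pd2 f)"

definition Hess :: "(real \<Rightarrow> real \<Rightarrow> real) \<Rightarrow> real \<Rightarrow> real \<Rightarrow> real ^ 2 ^ 2" where
  "Hess f a b = vector [vector [pd1 (pd1 f) a b, pd1 (pd2 f) a b],
                        vector [pd2 (pd1 f) a b, pd2 (pd2 f) a b]]"

definition negative_definite :: "real ^ 'n ^ 'n \<Rightarrow> bool" where
  "negative_definite A \<longleftrightarrow> transpose A = A \<and> (\<forall>v. v \<noteq> 0 \<longrightarrow> v \<bullet> (A *v v) < 0)"

end

theory Submission
  imports Defs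
begin

text \<open>
  The free energy is an infimum of functions that are affine in the multipliers, and the plane
  given by an optimal model touches it from above. Hence \<open>F\<close> is concave and its gradient is
  \<open>(D, C)\<close>. Comparing the optimal models at two parameter points with each other shows that the
  gradient is antitone, which makes the Hessian negative semidefinite, and that the error of the
  first-order expansion of \<open>R\<close> in \<open>(D, C)\<close> is at most the inner product of the two increments.
  Where the Hessian is nonsingular, the gradient map is open at the point, so nearby points of the
  surface come from nearby multipliers and the error is of lower order. The differentiability of
  the surface needs no smooth inverse of the gradient map. The dynamical identities are chain rules
  together with the symmetry of second derivatives.
\<close>

section \<open>Functions of two real variables\<close>

lemma square_in_open:
  fixes a b :: real
  assumes "open U" "(a, b) \<in> U"
  obtains h where "h > 0" "{a - h..a + h} \<times> {b - h..b + h} \<subseteq> U"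
proof -
  obtain A B where AB: "open A" "open B" "a \<in> A" "b \<in> B" "A \<times> B \<subseteq> U"
    using assms by (auto elim: open_prod_elim)
  obtain e1 where e1: "e1 > 0" "cball a e1 \<subseteq> A" using AB open_contains_cball by blast
  obtain e2 where e2: "e2 > 0" "cball b e2 \<subseteq> B" using AB open_contains_cball by blast
  have "{a - min e1 e2..a + min e1 e2} \<subseteq> A" "{b - min e1 e2..b + min e1 e2} \<subseteq> B"
    using e1 e2 by (force simp: cball_eq_atLeastAtMost)+
  then show thesis using that[of "min e1 e2"] e1 e2 AB(5) by fastforce
qed

section \<open>Total derivative and chain rule for \<open>C1_on\<close> functions\<close>

lemma C1_on_partial_derivatives:
  assumes "C1_on S f" "(a, b) \<in> S"
  shows "((\<lambda>s. f s b) has_real_derivative pd1 f a b) (at a)"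
    and "((\<lambda>s. f a s) has_real_derivative pd2 f a b) (at b)"
proof -
  have "(\<lambda>s. f s b) differentiable (at a)" "(\<lambda>s. f a s) differentiable (at b)"
    using assms by (auto simp: C1_on_def)
  then show "((\<lambda>s. f s b) has_real_derivative pd1 f a b) (at a)"
    "((\<lambda>s. f a s) has_real_derivative pd2 f a b) (at b)"
    unfolding pd1_def pd2_def by (simp_all add: DERIV_deriv_iff_real_differentiable)
qed

text \<open>An increment splits into a move in the first variable at height \<open>b\<close>,
  governed by the partial derivative at \<open>(a, b)\<close>, and a vertical move, governed by the
  mean value inequality because \<open>pd2 f\<close> is continuous at \<open>(a, b)\<close>.\<close>

lemma C1_on_has_derivative:
  assumes S: "open S" and f: "C1_on S f" and ab: "(a, b) \<in> S"
  shows "((\<lambda>(x, y). f x y) has_derivative (\<lambda>(h, k). pd1 f a b * h + pd2 f a b * k)) (at (a, b))"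
proof -
  obtain A B where AB: "open A" "open B" "a \<in> A" "b \<in> B" "A \<times> B \<subseteq> S"
    using S ab by (auto elim: open_prod_elim)
  \<comment> \<open>The vertical moves must stay in a convex set, so the second factor is cut down
    to a ball.\<close>
  then obtain e where e: "e > 0" "ball b e \<subseteq> B"
    using open_contains_ball by blast
  let ?B = "ball b e"
  have sub: "A \<times> ?B \<subseteq> S" using AB e by auto
  have "((\<lambda>(x, y). f x y) has_derivative
      (\<lambda>(h, k). pd1 f a b * h + blinfun_apply (blinfun_mult_right (pd2 f a b)) k)) (at (a, b) within A \<times> ?B)"
  proof (rule has_derivative_partialsI)
    show "((\<lambda>x. f x b) has_derivative (*) (pd1 f a b)) (at a within A)"
      using C1_on_partial_derivatives(1)[OF f ab]
      by (simp add: has_field_derivative_def has_derivative_at_withinI)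
    show "((\<lambda>y. f x y) has_derivative blinfun_apply (blinfun_mult_right (pd2 f x y))) (at y within ?B)"
      if "x \<in> A" "y \<in> ?B" for x y
    proof -
      have "(x, y) \<in> S" using that sub by blast
      from C1_on_partial_derivatives(2)[OF f this] show ?thesis
        by (simp add: has_field_derivative_def has_derivative_at_withinI)
    qed
    have "continuous_on S (\<lambda>(x, y). pd2 f x y)" using f by (simp add: C1_on_def)
    then have "continuous_on S (\<lambda>p. blinfun_mult_right (pd2 f (fst p) (snd p)))"
      by (intro bounded_linear.continuous_on[OF bounded_linear_blinfun_mult_right])
         (simp add: case_prod_beta)
    then have "continuous (at (a, b)) (\<lambda>p. blinfun_mult_right (pd2 f (fst p) (snd p)))"
      using S ab continuous_on_eq_continuous_at by blast
    then show "continuous (at (a, b) within A \<times> ?B) (\<lambda>(x, y). blinfun_mult_right (pd2 f x y))"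
      unfolding case_prod_unfold by (rule continuous_at_imp_continuous_at_within)
    show "b \<in> ?B" "convex ?B" using e by auto
  qed
  moreover have "at (a, b) within A \<times> ?B = at (a, b)"
    using AB e by (intro at_within_open) (auto intro: open_Times)
  ultimately show ?thesis by simp
qed

text \<open>Derivatives are taken within \<open>T\<close> so that the time set of a path can be
  arbitrary, with one-sided derivatives at end points of an interval.\<close>

lemma C1_on_chain:
  assumes "open S" "C1_on S f" "(u t, v t) \<in> S"
    and u: "(u has_real_derivative u') (at t within T)"
    and v: "(v has_real_derivative v') (at t within T)"
  shows "((\<lambda>s. f (u s) (v s)) has_real_derivative
           pd1 f (u t) (v t) * u' + pd2 f (u t) (v t) * v') (at t within T)"
proof -
  have "((\<lambda>s. (u s, v s)) has_derivative (\<lambda>h. (u' * h, v' * h))) (at t within T)"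
    using u v by (intro has_derivative_Pair) (simp_all add: has_field_derivative_def)
  note has_derivative_compose[OF this C1_on_has_derivative[OF assms(1-3)]]
  moreover have "(\<lambda>h. case (u' * h, v' * h) of (h, k) \<Rightarrow> pd1 f (u t) (v t) * h + pd2 f (u t) (v t) * k)
      = (*) (pd1 f (u t) (v t) * u' + pd2 f (u t) (v t) * v')"
    by (simp add: fun_eq_iff algebra_simps)
  ultimately show ?thesis by (simp add: has_field_derivative_def)
qed

section \<open>Symmetry of the mixed second partials\<close>

lemma mixed_difference_quotient:
  assumes f: "C1_on S f" and f1: "C1_on S (pd1 f)" and "h > 0"
    and sub: "{a..a + h} \<times> {b..b + h} \<subseteq> S"
  obtains x y where "a \<le> x" "x \<le> a + h" "b \<le> y" "y \<le> b + h"
    "f (a + h) (b + h) - f (a + h) b - f a (b + h) + f a b = h\<^sup>2 * pd2 (pd1 f) x y"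
proof -
  \<comment> \<open>The mean value theorem is used twice: in the first variable for the difference
    of \<open>f\<close> between the heights \<open>b + h\<close> and \<open>b\<close>, then in the
    second variable for \<open>pd1 f x\<close> at the intermediate point \<open>x\<close>.\<close>
  have "\<exists>x>a. x < a + h \<and> (f (a + h) (b + h) - f (a + h) b) - (f a (b + h) - f a b)
      = (a + h - a) * (pd1 f x (b + h) - pd1 f x b)"
    using \<open>h > 0\<close> sub
    by (intro MVT2 DERIV_diff C1_on_partial_derivatives(1)[OF f]) auto
  then obtain x where x: "a < x" "x < a + h"
    "(f (a + h) (b + h) - f (a + h) b) - (f a (b + h) - f a b) = h * (pd1 f x (b + h) - pd1 f x b)"
    by auto
  have "\<exists>y>b. y < b + h \<and> pd1 f x (b + h) - pd1 f x b = (b + h - b) * pd2 (pd1 f) x y"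
    using \<open>h > 0\<close> sub x by (intro MVT2 C1_on_partial_derivatives(2)[OF f1]) auto
  then obtain y where "b < y" "y < b + h" "pd1 f x (b + h) - pd1 f x b = h * pd2 (pd1 f) x y"
    by auto
  with x show thesis by (intro that[of x y]) (auto simp: power2_eq_square algebra_simps)
qed

text \<open>
  As higher-order patterns the left-hand sides match every function, so rewriting needs a fixed \<open>f\<close>.
\<close>

lemma pd_flip: "pd1 (\<lambda>x y. f y x) = (\<lambda>x y. pd2 f y x)" "pd2 (\<lambda>x y. f y x) = (\<lambda>x y. pd1 f y x)"
  by (simp_all add: pd1_def pd2_def fun_eq_iff)

lemma C1_on_flip:
  assumes "C1_on S f"
  shows "C1_on (prod.swap ` S) (\<lambda>x y. f y x)"
proof -
  have *: "continuous_on (prod.swap ` S) (\<lambda>(a, b). g b a)"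
    if "continuous_on S (\<lambda>(a, b). g a b)" for g :: "real \<Rightarrow> real \<Rightarrow> real"
  proof -
    have "continuous_on (prod.swap ` S) ((\<lambda>(a, b). g a b) \<circ> prod.swap)"
      using that by (intro continuous_on_compose continuous_on_swap) (simp add: image_image)
    then show ?thesis by (simp add: o_def case_prod_beta)
  qed
  show ?thesis using assms *[of "pd1 f"] *[of "pd2 f"]
    by (auto simp: C1_on_def pd_flip[of f])
qed

text \<open>The double difference over a square is unchanged when the variables are swapped, so it
  is the squared side times either mixed partial, each at some point of the square. The two points
  may differ; continuity is what keeps unequal values apart on a whole small square.\<close>

lemma mixed_partials_eq:
  assumes S: "open S" and f: "C2_on S f" and ab: "(a, b) \<in> S"
  shows "pd2 (pd1 f) a b = pd1 (pd2 f) a b"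
proof (rule ccontr)
  assume ne: "pd2 (pd1 f) a b \<noteq> pd1 (pd2 f) a b"
  define A where "A = (\<lambda>q. pd2 (pd1 f) (fst q) (snd q))"
  define B where "B = (\<lambda>q. pd1 (pd2 f) (fst q) (snd q))"
  have C1: "C1_on S f" "C1_on S (pd1 f)" "C1_on S (pd2 f)" using f by (auto simp: C2_on_def)
  have contA: "continuous_on S A" and contB: "continuous_on S B"
    using C1 by (auto simp: C1_on_def A_def B_def case_prod_beta)
  from ne obtain U V where UV: "open U" "open V" "A (a, b) \<in> U" "B (a, b) \<in> V" "U \<inter> V = {}"
    unfolding A_def B_def by (metis hausdorff fst_conv snd_conv)
  have op: "open ((A -` U \<inter> S) \<inter> (B -` V \<inter> S))"
    using contA contB S UV continuous_on_open_vimage by blast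
  obtain h where h: "h > 0" "{a - h..a + h} \<times> {b - h..b + h} \<subseteq> (A -` U \<inter> S) \<inter> (B -` V \<inter> S)"
    using square_in_open[OF op, of a b] UV ab by auto
  then have sub: "{a..a + h} \<times> {b..b + h} \<subseteq> (A -` U \<inter> S) \<inter> (B -` V \<inter> S)"
    by (elim order_trans[rotated]) auto
  obtain x y where xy: "a \<le> x" "x \<le> a + h" "b \<le> y" "y \<le> b + h"
    "f (a + h) (b + h) - f (a + h) b - f a (b + h) + f a b = h\<^sup>2 * pd2 (pd1 f) x y"
    using mixed_difference_quotient[OF C1(1,2) \<open>h > 0\<close>, of a b] sub by blast
  have flip_sub: "{b..b + h} \<times> {a..a + h} \<subseteq> prod.swap ` S"
    using sub by (force simp: image_iff)
  \<comment> \<open>For the swapped function the same double difference produces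
    \<open>pd1 (pd2 f)\<close>.\<close>
  have "C1_on (prod.swap ` S) (pd1 (\<lambda>x y. f y x))"
    using C1_on_flip[OF C1(3)] by (simp add: pd_flip[of f])
  note mixed_difference_quotient[OF C1_on_flip[OF C1(1)] this \<open>h > 0\<close> flip_sub, unfolded pd_flip[of f] pd_flip[of "pd2 f"]]
  then obtain y' x' where xy': "b \<le> y'" "y' \<le> b + h" "a \<le> x'" "x' \<le> a + h"
    "f (a + h) (b + h) - f a (b + h) - f (a + h) b + f a b = h\<^sup>2 * pd1 (pd2 f) x' y'"
    .
  have "(x, y) \<in> {a..a + h} \<times> {b..b + h}" "(x', y') \<in> {a..a + h} \<times> {b..b + h}"
    using xy xy' by auto
  then have "A (x, y) \<in> U" "B (x', y') \<in> V"
    using sub by blast+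
  moreover have "A (x, y) = B (x', y')"
  proof -
    have "h\<^sup>2 * pd2 (pd1 f) x y = h\<^sup>2 * pd1 (pd2 f) x' y'" using xy(5) xy'(5) by linarith
    then show ?thesis using \<open>h > 0\<close> by (simp add: A_def B_def)
  qed
  ultimately show False using UV by auto
qed

section \<open>Derivatives of functions that agree on an open set\<close>

lemma pd_cong_open:
  assumes "open S" "(a, b) \<in> S" and eq: "\<And>x y. (x, y) \<in> S \<Longrightarrow> f x y = g x y"
  shows "pd1 f a b = pd1 g a b" "pd2 f a b = pd2 g a b"
proof -
  obtain A B where AB: "open A" "open B" "a \<in> A" "b \<in> B" "A \<times> B \<subseteq> S"
    using assms by (auto elim: open_prod_elim)
  have "\<forall>\<^sub>F s in nhds a. f s b = g s b"
    using AB eq by (intro eventually_nhds[THEN iffD2] exI[of _ A]) auto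
  then show "pd1 f a b = pd1 g a b" unfolding pd1_def by (intro deriv_cong_ev) auto
  have "\<forall>\<^sub>F s in nhds b. f a s = g a s"
    using AB eq by (intro eventually_nhds[THEN iffD2] exI[of _ B]) auto
  then show "pd2 f a b = pd2 g a b" unfolding pd2_def by (intro deriv_cong_ev) auto
qed

text \<open>Needed because \<open>D\<close> and \<open>C\<close> coincide with the partials of
  \<open>F\<close> only on \<Omega>, where they inherit their regularity.\<close>

lemma C1_on_cong_open:
  assumes "open S" and eq: "\<And>x y. (x, y) \<in> S \<Longrightarrow> f x y = g x y" and g: "C1_on S g"
  shows "C1_on S f"
proof -
  have "(\<lambda>s. f s b) differentiable (at a) \<and> (\<lambda>s. f a s) differentiable (at b)"
    if ab: "(a, b) \<in> S" for a b
  proof -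
    obtain A B where AB: "open A" "open B" "a \<in> A" "b \<in> B" "A \<times> B \<subseteq> S"
      using \<open>open S\<close> ab by (auto elim: open_prod_elim)
    have "((\<lambda>s. f s b) has_real_derivative pd1 g a b) (at a)"
      by (rule DERIV_cong_ev[THEN iffD2, OF refl _ refl C1_on_partial_derivatives(1)[OF g ab]])
         (use AB eq in \<open>auto simp: eventually_nhds\<close>)
    moreover have "((\<lambda>s. f a s) has_real_derivative pd2 g a b) (at b)"
      by (rule DERIV_cong_ev[THEN iffD2, OF refl _ refl C1_on_partial_derivatives(2)[OF g ab]])
         (use AB eq in \<open>auto simp: eventually_nhds\<close>)
    ultimately show ?thesis by (auto simp: real_differentiable_def)
  qed
  moreover have "continuous_on S (\<lambda>(a, b). pd1 f a b)" "continuous_on S (\<lambda>(a, b). pd2 f a b)"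
    using g pd_cong_open[OF \<open>open S\<close> _ eq]
    by (auto simp: C1_on_def intro: continuous_on_cong[THEN iffD1, rotated -1])
  ultimately show ?thesis by (auto simp: C1_on_def)
qed

text \<open>Composing with the two coordinate lines through the point reads off the coefficients.
  This extracts the slopes of the surface from its total derivative.\<close>

lemma has_derivative_pd:
  assumes "((\<lambda>(x, y). f x y) has_derivative (\<lambda>(h, k). u * h + v * k)) (at (a, b))"
  shows "pd1 f a b = u" "pd2 f a b = v"
proof -
  have "((\<lambda>s. (s, b)) has_derivative (\<lambda>h. (h, 0))) (at a)"
       "((\<lambda>s. (a, s)) has_derivative (\<lambda>h. (0, h))) (at b)"
    by (auto intro!: derivative_eq_intros)
  from this[THEN has_derivative_compose, OF assms]
  have "((\<lambda>s. f s b) has_real_derivative u) (at a)" "((\<lambda>s. f a s) has_real_derivative v) (at b)"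
    by (simp_all add: has_field_derivative_def)
  then show "pd1 f a b = u" "pd2 f a b = v"
    unfolding pd1_def pd2_def by (auto intro: DERIV_imp_deriv)
qed


section \<open>Quadratic forms in two variables\<close>

text \<open>Completing the square: \<open>a\<close> times the form is
  \<open>(a * x + b * y)\<^sup>2 + (a * c - b\<^sup>2) * y\<^sup>2\<close>, which is positive away
  from the origin once the determinant is positive.\<close>

lemma nonpos_quadratic_form_nondegenerate:
  fixes a b c :: real
  assumes le: "\<And>x y. a * x\<^sup>2 + 2 * b * x * y + c * y\<^sup>2 \<le> 0" and ne: "a * c - b\<^sup>2 \<noteq> 0"
  shows "a < 0" "c < 0" "a * c - b\<^sup>2 > 0"
    and "x \<noteq> 0 \<or> y \<noteq> 0 \<Longrightarrow> a * x\<^sup>2 + 2 * b * x * y + c * y\<^sup>2 < 0"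
proof -
  have "a \<noteq> 0"
  proof
    assume "a = 0"
    with ne have "b \<noteq> 0" by auto
    \<comment> \<open>With \<open>a = 0\<close> the form is affine in \<open>x\<close> at
      \<open>y = 1\<close>; this \<open>x\<close> makes its value 1.\<close>
    with le[of "(1 - c) / (2 * b)" 1] \<open>a = 0\<close> show False by simp
  qed
  with le[of 1 0] show a: "a < 0" by simp
  \<comment> \<open>The point \<open>(b, - a)\<close> annihilates \<open>a * x + b * y\<close>,
    leaving \<open>a\<close> times the determinant.\<close>
  have "a * (a * c - b\<^sup>2) \<le> 0"
    using le[of b "- a"] by (simp add: algebra_simps power2_eq_square)
  with a ne show det: "a * c - b\<^sup>2 > 0" by (simp add: mult_le_0_iff)
  then have "a * c > 0" using zero_le_power2[of b] by linarith
  with a show "c < 0" by (simp add: zero_less_mult_iff)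
  assume xy: "x \<noteq> 0 \<or> y \<noteq> 0"
  have "a * (a * x\<^sup>2 + 2 * b * x * y + c * y\<^sup>2) = (a * x + b * y)\<^sup>2 + (a * c - b\<^sup>2) * y\<^sup>2"
    by (simp add: algebra_simps power2_eq_square)
  moreover have "(a * x + b * y)\<^sup>2 + (a * c - b\<^sup>2) * y\<^sup>2 > 0"
  proof (cases "y = 0")
    case True
    with xy a show ?thesis by simp
  next
    case False
    with det show ?thesis by (intro add_nonneg_pos mult_pos_pos) auto
  qed
  ultimately have "a * (a * x\<^sup>2 + 2 * b * x * y + c * y\<^sup>2) > 0" by (simp only:)
  with a show "a * x\<^sup>2 + 2 * b * x * y + c * y\<^sup>2 < 0"
    by (metis less_asym zero_less_mult_iff)
qed

lemma negative_definite_2: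
  fixes a b c :: real
  assumes "\<And>x y. x \<noteq> 0 \<or> y \<noteq> 0 \<Longrightarrow> a * x\<^sup>2 + 2 * b * x * y + c * y\<^sup>2 < 0"
  shows "negative_definite (vector [vector [a, b], vector [b, c]] :: real ^ 2 ^ 2)"
  unfolding negative_definite_def
proof (intro conjI allI impI)
  let ?A = "vector [vector [a, b], vector [b, c]] :: real ^ 2 ^ 2"
  show "transpose ?A = ?A" by (simp add: vec_eq_iff forall_2 transpose_def)
  fix v :: "real ^ 2" assume "v \<noteq> 0"
  then have "v $ 1 \<noteq> 0 \<or> v $ 2 \<noteq> 0" by (simp add: vec_eq_iff forall_2)
  from assms[OF this] show "v \<bullet> (?A *v v) < 0"
    by (simp add: inner_vec_def sum_2 matrix_vector_mult_def algebra_simps power2_eq_square)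
qed

section \<open>Concave functions given by their supporting planes\<close>

text \<open>All that the analysis uses of the minimization: each optimal model contributes an affine
  function of the multipliers, with slopes \<open>D\<close> and \<open>C\<close>, that dominates
  \<open>F\<close> on \<Omega> and meets it at its own point. The optimal model may be chosen
  arbitrarily at each point, so smoothness is demanded of \<open>F\<close> alone.\<close>

locale supporting_planes =
  fixes R D C F :: "real \<Rightarrow> real \<Rightarrow> real" and \<Omega> :: "(real \<times> real) set"
  assumes open_dom: "open \<Omega>" and C2: "C2_on \<Omega> F"
    and F_eq: "(l, g) \<in> \<Omega> \<Longrightarrow> F l g = R l g + l * D l g + g * C l g"
    and F_le: "(l, g) \<in> \<Omega> \<Longrightarrow> (l', g') \<in> \<Omega> \<Longrightarrow> F l g \<le> R l' g' + l * D l' g' + g * C l' g'"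
begin

section \<open>The gradient of the free energy\<close>

lemma D_eq_pd1_F:
  assumes "(l, g) \<in> \<Omega>"
  shows "D l g = pd1 F l g"
proof -
  have "((\<lambda>s. F s g - s * D l g) has_real_derivative pd1 F l g - 1 * D l g) (at l)"
    using C2 assms by (intro DERIV_diff C1_on_partial_derivatives DERIV_cmult_right DERIV_ident)
      (auto simp: C2_on_def)
  moreover obtain h where "h > 0" and h: "{l - h..l + h} \<times> {g - h..g + h} \<subseteq> \<Omega>"
    using square_in_open[OF open_dom assms] .
  \<comment> \<open>Envelope argument: with the model optimal at \<open>(l, g)\<close> held fixed,
    \<open>F\<close> minus its linear part in \<open>s\<close> is largest at \<open>s = l\<close>,
    so its derivative vanishes there.\<close>
  moreover have "\<forall>s. \<bar>l - s\<bar> < h \<longrightarrow> F s g - s * D l g \<le> F l g - l * D l g"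
  proof safe
    fix s assume "\<bar>l - s\<bar> < h"
    then have "(s, g) \<in> {l - h..l + h} \<times> {g - h..g + h}" using \<open>h > 0\<close> by auto
    with h have "(s, g) \<in> \<Omega>" by blast
    then show "F s g - s * D l g \<le> F l g - l * D l g" using F_le F_eq assms by fastforce
  qed
  ultimately have "pd1 F l g - 1 * D l g = 0" using DERIV_local_max by blast
  then show ?thesis by simp
qed

text \<open>Distortion and classification loss enter symmetrically; exchanging them turns a
  statement on the first partial into one on the second.\<close>

lemma flip: "supporting_planes (\<lambda>l g. R g l) (\<lambda>l g. C g l) (\<lambda>l g. D g l) (\<lambda>l g. F g l) (prod.swap ` \<Omega>)"
proof
  have "prod.swap ` \<Omega> = prod.swap -` \<Omega>" by (force simp: image_iff)
  then show "open (prod.swap ` \<Omega>)"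
    using open_dom by (simp add: open_vimage continuous_on_swap)
  show "C2_on (prod.swap ` \<Omega>) (\<lambda>l g. F g l)"
    using C2 C1_on_flip unfolding C2_on_def pd_flip[of F] by blast
  show "F g l = R g l + l * C g l + g * D g l" if "(l, g) \<in> prod.swap ` \<Omega>" for l g
    using that F_eq[of g l] by auto
  show "F g l \<le> R g' l' + l * C g' l' + g * D g' l'"
    if "(l, g) \<in> prod.swap ` \<Omega>" "(l', g') \<in> prod.swap ` \<Omega>" for l g l' g'
    using that F_le[of g l g' l'] by auto
qed

lemma C_eq_pd2_F:
  assumes "(l, g) \<in> \<Omega>"
  shows "C l g = pd2 F l g"
proof -
  have "(g, l) \<in> prod.swap ` \<Omega>" using assms by force
  from supporting_planes.D_eq_pd1_F[OF flip this] show ?thesis by (simp add: pd_flip[of F])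
qed

lemma C1_D: "C1_on \<Omega> D" and C1_C: "C1_on \<Omega> C" and C1_F: "C1_on \<Omega> F"
  using C2 C1_on_cong_open[OF open_dom D_eq_pd1_F] C1_on_cong_open[OF open_dom C_eq_pd2_F]
  by (auto simp: C2_on_def)

lemma second_partials:
  assumes "(l, g) \<in> \<Omega>"
  shows "pd1 D l g = pd1 (pd1 F) l g" "pd2 D l g = pd1 (pd2 F) l g"
    "pd1 C l g = pd1 (pd2 F) l g" "pd2 C l g = pd2 (pd2 F) l g"
    "pd2 (pd1 F) l g = pd1 (pd2 F) l g"
  using pd_cong_open[OF open_dom assms D_eq_pd1_F] pd_cong_open[OF open_dom assms C_eq_pd2_F]
    mixed_partials_eq[OF open_dom C2 assms] by auto

section \<open>Concavity and the sign of the Hessian\<close>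

lemma F_concave:
  assumes "S \<subseteq> \<Omega>" "convex S"
  shows "concave_on S (\<lambda>(l, g). F l g)"
  unfolding concave_on_iff
proof (intro conjI ballI allI impI)
  fix x y and u v :: real
  assume xy: "x \<in> S" "y \<in> S" and uv: "0 \<le> u" "0 \<le> v" "u + v = 1"
  obtain l g l' g' where [simp]: "x = (l, g)" "y = (l', g')" by fastforce
  define m n where "m = u * l + v * l'" and "n = u * g + v * g'"
  have "u *\<^sub>R x + v *\<^sub>R y \<in> S" using assms(2) xy uv by (rule convexD)
  then have mn: "(m, n) \<in> \<Omega>" using assms(1) by (auto simp: m_def n_def)
  let ?A = "\<lambda>l g. R m n + l * D m n + g * C m n"
  \<comment> \<open>Both end values are bounded by the plane supporting \<open>F\<close> at the
    intermediate point. Being affine, that plane averages to its value there, which is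
    \<open>F m n\<close>.\<close>
  have "u * F l g + v * F l' g' \<le> u * ?A l g + v * ?A l' g'"
    using F_le[OF _ mn] assms xy uv by (intro add_mono mult_left_mono) auto
  also have "\<dots> = (u + v) * R m n + m * D m n + n * C m n"
    by (simp add: m_def n_def algebra_simps)
  also have "\<dots> = F m n" using F_eq[OF mn] uv by simp
  finally show "u * (case x of (l, g) \<Rightarrow> F l g) + v * (case y of (l, g) \<Rightarrow> F l g)
      \<le> (case u *\<^sub>R x + v *\<^sub>R y of (l, g) \<Rightarrow> F l g)"
    by (simp add: m_def n_def)
qed (use assms in auto)

text \<open>Each optimal model is tested at the other's multipliers; on adding the two inequalities
  the rates cancel.\<close>

lemma gradient_antitone:
  assumes "(l, g) \<in> \<Omega>" "(l', g') \<in> \<Omega>"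
  shows "(l' - l) * (D l' g' - D l g) + (g' - g) * (C l' g' - C l g) \<le> 0"
  using F_le[OF assms] F_le[OF assms(2,1)] F_eq[OF assms(1)] F_eq[OF assms(2)]
  by (simp add: algebra_simps)

text \<open>The quadratic form is the derivative at 0 of the gradient increment along the line in
  direction \<open>(u, v)\<close>, paired with that direction. A positive derivative would make this
  pairing positive for small positive parameters, against antitonicity.\<close>

lemma Hess_nonpos:
  assumes lg: "(l, g) \<in> \<Omega>"
  shows "pd1 (pd1 F) l g * u\<^sup>2 + 2 * pd1 (pd2 F) l g * u * v + pd2 (pd2 F) l g * v\<^sup>2 \<le> 0"
proof (rule ccontr)
  let ?\<phi> = "\<lambda>s. (D (l + s * u) (g + s * v) - D l g) * u + (C (l + s * u) (g + s * v) - C l g) * v"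
  let ?q = "pd1 (pd1 F) l g * u\<^sup>2 + 2 * pd1 (pd2 F) l g * u * v + pd2 (pd2 F) l g * v\<^sup>2"
  assume pos: "\<not> ?q \<le> 0"
  have path: "((\<lambda>s. l + s * u) has_real_derivative u) (at 0)" "((\<lambda>s. g + s * v) has_real_derivative v) (at 0)"
    by (auto intro!: derivative_eq_intros)
  have "(?\<phi> has_real_derivative
      (pd1 D l g * u + pd2 D l g * v - 0) * u + (pd1 C l g * u + pd2 C l g * v - 0) * v) (at 0)"
    using C1_on_chain[OF open_dom C1_D _ path] C1_on_chain[OF open_dom C1_C _ path] lg
    by (intro DERIV_add DERIV_cmult_right DERIV_diff DERIV_const) auto
  then have "(?\<phi> has_real_derivative ?q) (at 0)"
    by (simp add: second_partials[OF lg] algebra_simps power2_eq_square)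
  then obtain d where "d > 0" and d: "\<And>s. 0 < s \<Longrightarrow> s < d \<Longrightarrow> ?\<phi> 0 < ?\<phi> (0 + s)"
    using DERIV_pos_inc_right[of ?\<phi> ?q 0] pos by auto
  have "isCont (\<lambda>s. (l + s * u, g + s * v)) 0" by (intro continuous_intros)
  then have "\<forall>\<^sub>F s in at 0. (l + s * u, g + s * v) \<in> \<Omega>"
    using open_dom lg by (auto simp: isCont_def dest!: topological_tendstoD)
  then have "\<forall>\<^sub>F s in at_right 0. (l + s * u, g + s * v) \<in> \<Omega>"
    by (simp add: eventually_at_split)
  moreover have "\<forall>\<^sub>F s in at_right 0. s \<in> {0<..<d}"
    using \<open>d > 0\<close> by (rule eventually_at_right_real)
  ultimately have "\<forall>\<^sub>F s in at_right 0. (l + s * u, g + s * v) \<in> \<Omega> \<and> s \<in> {0<..<d}"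
    by (rule eventually_conj)
  then obtain s where s: "(l + s * u, g + s * v) \<in> \<Omega>" "0 < s" "s < d"
    using eventually_happens'[OF trivial_limit_at_right_real] by fastforce
  have "s * ?\<phi> s \<le> 0" using gradient_antitone[OF lg s(1)] by (simp add: algebra_simps)
  with d[OF s(2,3)] s(2) show False by (simp add: mult_le_0_iff)
qed

section \<open>Differentiability of the surface of optimal triples\<close>

lemma gradient_open_at:
  assumes lg: "(l, g) \<in> \<Omega>" and U: "open U" "(l, g) \<in> U"
    and det: "pd1 D l g * pd2 C l g - pd2 D l g * pd1 C l g \<noteq> 0"
  shows "(D l g, C l g) \<in> interior ((\<lambda>(x, y). (D x y, C x y)) ` (U \<inter> \<Omega>))"
proof -
  define G where "G = (\<lambda>(x, y). (D x y, C x y))"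
  define a b a' b' where "a = pd1 D l g" and "b = pd2 D l g" and "a' = pd1 C l g" and "b' = pd2 C l g"
  define \<Delta> where "\<Delta> = a * b' - b * a'"
  let ?G' = "\<lambda>(h, k). (a * h + b * k, a' * h + b' * k)"
  \<comment> \<open>Inverse of the Jacobian \<open>?G'\<close> by Cramer's rule; \<Delta> is its
    determinant.\<close>
  let ?H = "\<lambda>(u, v). ((b' * u - b * v) / \<Delta>, (a * v - a' * u) / \<Delta>)"
  have G: "(G has_derivative (\<lambda>(h, k). (pd1 D x y * h + pd2 D x y * k, pd1 C x y * h + pd2 C x y * k))) (at (x, y))"
    if "(x, y) \<in> \<Omega>" for x y
    using has_derivative_Pair[OF C1_on_has_derivative[OF open_dom C1_D that]
        C1_on_has_derivative[OF open_dom C1_C that]]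
    by (simp add: G_def case_prod_unfold)
  have "continuous_on \<Omega> G"
  proof (intro continuous_at_imp_continuous_on ballI)
    fix q assume "q \<in> \<Omega>"
    then show "isCont G q"
      using has_derivative_continuous[OF G[of "fst q" "snd q"]] by simp
  qed
  moreover have "(G has_derivative ?G') (at (l, g))"
    using G[OF lg] by (simp add: a_def b_def a'_def b'_def)
  moreover have "bounded_linear ?H"
    by (intro linear_conv_bounded_linear[THEN iffD1] linearI)
       (simp_all add: case_prod_unfold add_divide_distrib diff_divide_distrib right_diff_distrib distrib_left mult.left_commute)
  moreover have "?G' \<circ> ?H = id"
  proof
    fix p :: "real \<times> real"
    have "\<Delta> \<noteq> 0" using det by (simp add: \<Delta>_def a_def b_def a'_def b'_def)
    moreover have "a * (b' * u - b * v) + b * (a * v - a' * u) = \<Delta> * u"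
      "a' * (b' * u - b * v) + b' * (a * v - a' * u) = \<Delta> * v" for u v
      by (simp_all add: \<Delta>_def algebra_simps)
    ultimately show "(?G' \<circ> ?H) p = id p"
      by (cases p) (simp add: add_divide_distrib[symmetric])
  qed
  moreover have "(l, g) \<in> interior (U \<inter> \<Omega>)"
    using lg U open_dom by (simp add: interior_open open_Int)
  \<comment> \<open>Sussmann's theorem asks only for continuity near the point and a
    right-invertible derivative at the point itself.\<close>
  ultimately have "G (l, g) \<in> interior (G ` (U \<inter> \<Omega>))"
    using sussmann_open_mapping[of \<Omega> G "(l, g)" ?G' ?H "U \<inter> \<Omega>"] open_dom lg by blast
  then show ?thesis by (simp add: G_def)
qed

text \<open>The model optimal at \<open>(l, g)\<close> minimizes \<open>R + l D + g C\<close> over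
  the surface, so the affine function with slopes \<open>- l\<close> and \<open>- g\<close> touches
  the surface from below; the exchange inequality bounds the gap from above.\<close>

lemma surface_has_derivative:
  assumes \<rho>: "\<And>l g. (l, g) \<in> \<Omega> \<Longrightarrow> \<rho> (D l g) (C l g) = R l g" and lg: "(l, g) \<in> \<Omega>"
    and det: "pd1 D l g * pd2 C l g - pd2 D l g * pd1 C l g \<noteq> 0"
  shows "((\<lambda>(x, y). \<rho> x y) has_derivative (\<lambda>(h, k). - l * h + - g * k)) (at (D l g, C l g))"
  unfolding has_derivative_at_alt
proof (intro conjI allI impI)
  show "bounded_linear (\<lambda>(h, k). - l * h + - g * k)"
    by (intro linear_conv_bounded_linear[THEN iffD1] linearI) (auto simp: algebra_simps)
  fix e :: real assume "e > 0"
  \<comment> \<open>The tolerance \<open>e\<close> doubles as the radius in multiplier space: every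
    pair close to \<open>(D l g, C l g)\<close> is attained at multipliers within \<open>e\<close>,
    and this distance becomes the coefficient in the final estimate.\<close>
  then have "(D l g, C l g) \<in> interior ((\<lambda>(x, y). (D x y, C x y)) ` (ball (l, g) e \<inter> \<Omega>))"
    by (intro gradient_open_at lg det) auto
  then obtain \<delta> where "\<delta> > 0"
    and \<delta>: "ball (D l g, C l g) \<delta> \<subseteq> (\<lambda>(x, y). (D x y, C x y)) ` (ball (l, g) e \<inter> \<Omega>)"
    by (auto simp: mem_interior)
  show "\<exists>\<delta>>0. \<forall>y. norm (y - (D l g, C l g)) < \<delta> \<longrightarrow>
      norm ((case y of (x, y) \<Rightarrow> \<rho> x y) - (case (D l g, C l g) of (x, y) \<Rightarrow> \<rho> x y)
        - (case y - (D l g, C l g) of (h, k) \<Rightarrow> - l * h + - g * k)) \<le> e * norm (y - (D l g, C l g))"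
  proof (intro exI conjI allI impI)
    fix y assume "norm (y - (D l g, C l g)) < \<delta>"
    then have "y \<in> ball (D l g, C l g) \<delta>" by (simp add: dist_norm norm_minus_commute)
    then obtain l' g' where y: "y = (D l' g', C l' g')" and lg': "(l', g') \<in> \<Omega>"
      and near: "dist (l, g) (l', g') < e"
      using \<delta> by auto
    let ?err = "R l' g' - R l g + l * (D l' g' - D l g) + g * (C l' g' - C l g)"
    \<comment> \<open>The lower bound is optimality at \<open>(l, g)\<close>, the upper one
      optimality at \<open>(l', g')\<close>.\<close>
    have "0 \<le> ?err" "?err \<le> - ((l' - l, g' - g) \<bullet> (D l' g' - D l g, C l' g' - C l g))"
      using F_le[OF lg lg'] F_le[OF lg' lg] F_eq[OF lg] F_eq[OF lg'] by (simp_all add: algebra_simps)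
    then have "\<bar>?err\<bar> \<le> \<bar>(l' - l, g' - g) \<bullet> (D l' g' - D l g, C l' g' - C l g)\<bar>" by linarith
    also have "\<dots> \<le> norm (l' - l, g' - g) * norm (D l' g' - D l g, C l' g' - C l g)"
      by (rule Cauchy_Schwarz_ineq2)
    also have "\<dots> \<le> e * norm (D l' g' - D l g, C l' g' - C l g)"
      using near norm_minus_commute[of "(l, g)" "(l', g')"] by (intro mult_right_mono) (simp_all add: dist_norm)
    finally show "norm ((case y of (x, y) \<Rightarrow> \<rho> x y) - (case (D l g, C l g) of (x, y) \<Rightarrow> \<rho> x y)
        - (case y - (D l g, C l g) of (h, k) \<Rightarrow> - l * h + - g * k)) \<le> e * norm (y - (D l g, C l g))"
      using \<rho>[OF lg] \<rho>[OF lg'] by (simp add: y algebra_simps)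
  qed (rule \<open>\<delta> > 0\<close>)
qed

text \<open>Writing \<open>R\<close> as \<open>F - l D - g C\<close>, the terms from the gradient of
  \<open>F\<close> cancel those from differentiating the multipliers. Working with \<open>F\<close>
  gives the formula also where the Hessian is singular and the surface may fail to be
  differentiable.\<close>

lemma R_along_path:
  assumes path: "\<And>s. s \<in> T \<Longrightarrow> (u s, v s) \<in> \<Omega>" and t: "t \<in> T"
    and u: "(u has_real_derivative u') (at t within T)"
    and v: "(v has_real_derivative v') (at t within T)"
    and D: "((\<lambda>s. D (u s) (v s)) has_real_derivative D') (at t within T)"
    and C: "((\<lambda>s. C (u s) (v s)) has_real_derivative C') (at t within T)"
  shows "((\<lambda>s. R (u s) (v s)) has_real_derivative - u t * D' - v t * C') (at t within T)"
proof -
  have "((\<lambda>s. F (u s) (v s)) has_real_derivative D (u t) (v t) * u' + C (u t) (v t) * v') (at t within T)"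
    using C1_on_chain[OF open_dom C1_F path[OF t] u v] D_eq_pd1_F[OF path[OF t]] C_eq_pd2_F[OF path[OF t]]
    by simp
  then have "((\<lambda>s. F (u s) (v s) - u s * D (u s) (v s) - v s * C (u s) (v s)) has_real_derivative
      - u t * D' - v t * C') (at t within T)"
    by (auto intro!: derivative_eq_intros u v D C)
  then show ?thesis
    by (rule has_field_derivative_transform_within[OF _ zero_less_one t]) (simp add: F_eq path)
qed

end

section \<open>Optimal models\<close>

text \<open>Each model is tested against the other at its own multipliers; equal distortions and
  losses cancel. This makes the description in \<open>surface_rate\<close> unique, even when one
  point of the surface arises from several multipliers.\<close>

lemma optimal_same_rate:
  assumes "is_optimal p \<nu> lab Q l g q" "is_optimal p \<nu> lab Q l' g' q'"
    and "distortion p \<nu> q = distortion p \<nu> q'" "class_loss p \<nu> lab q = class_loss p \<nu> lab q'"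
  shows "rate p \<nu> q = rate p \<nu> q'"
proof -
  have "lagrangian p \<nu> lab l g q \<le> lagrangian p \<nu> lab l g q'"
    "lagrangian p \<nu> lab l' g' q' \<le> lagrangian p \<nu> lab l' g' q"
    using assms by (auto simp: is_optimal_def)
  with assms show ?thesis by (simp add: lagrangian_def)
qed

lemma surface_rate_optimal:
  assumes "(l, g) \<in> \<Omega>" "is_optimal p \<nu> lab Q l g q"
  shows "surface_rate p \<nu> lab Q \<Omega> (distortion p \<nu> q) (class_loss p \<nu> lab q) = rate p \<nu> q"
  unfolding surface_rate_def
proof (rule the_equality)
  fix r
  assume "\<exists>l g q'. (l, g) \<in> \<Omega> \<and> is_optimal p \<nu> lab Q l g q' \<and> rate p \<nu> q' = r \<and>
    distortion p \<nu> q' = distortion p \<nu> q \<and> class_loss p \<nu> lab q' = class_loss p \<nu> lab q"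
  then show "r = rate p \<nu> q" using optimal_same_rate[OF _ assms(2)] by metis
qed (use assms in blast)

lemma free_energy_optimal:
  assumes "is_optimal p \<nu> lab Q l g q"
  shows "free_energy p \<nu> lab Q l g = lagrangian p \<nu> lab l g q"
  unfolding free_energy_def using assms
  by (intro cInf_eq_minimum) (auto simp: is_optimal_def)

text \<open>Concavity yields only a semidefinite Hessian, and a singular one makes
  \<open>Ddot\<close> vanish. The strict signs and the slopes of the surface are therefore asserted
  where the determinant is nonzero, which with semidefiniteness amounts to negative definiteness.
  The trade-off carries \<open>lam t > 0\<close> because the sign of \<open>Rdot\<close> depends on
  it.\<close>

theorem mainTheorem6:
  fixes \<mu> p :: "'x measure" and \<nu> :: "'z measure" and lab :: "'x \<Rightarrow> 'y"
    and Q :: "('x, 'y, 'z) model set"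
    and opt :: "real \<Rightarrow> real \<Rightarrow> ('x, 'y, 'z) model"
    and F R D C :: "real \<Rightarrow> real \<Rightarrow> real"
    and \<Omega> :: "(real \<times> real) set"
    and \<alpha> :: real and T :: "real set"
    and lam gam lamdot gamdot :: "real \<Rightarrow> real"
  assumes "sigma_finite_measure \<mu>" and "sigma_finite_measure \<nu>"
    and "prob_space p" and "sets p = sets \<mu>" and "lab \<in> measurable p (count_space UNIV)"
    and "\<forall>q\<in>Q. admissible \<mu> p \<nu> lab q"
    and "open \<Omega>"
    and "\<forall>(l, g)\<in>\<Omega>. is_optimal p \<nu> lab Q l g (opt l g)"
    and "F = free_energy p \<nu> lab Q"
    and "R = (\<lambda>l g. rate p \<nu> (opt l g))"
    and "D = (\<lambda>l g. distortion p \<nu> (opt l g))"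
    and "C = (\<lambda>l g. class_loss p \<nu> lab (opt l g))"
    and "C2_on \<Omega> F"
    and "\<forall>t\<in>T. (lam t, gam t) \<in> \<Omega>"
    and "\<forall>t\<in>T. (lam has_real_derivative lamdot t) (at t within T)"
    and "\<forall>t\<in>T. (gam has_real_derivative gamdot t) (at t within T)"
    and "\<forall>t\<in>T. lamdot t = - \<alpha> * pd2 C (lam t) (gam t)"
    and "\<forall>t\<in>T. gamdot t = \<alpha> * pd1 C (lam t) (gam t)"
  shows "(\<forall>(l, g)\<in>\<Omega>.
            D l g = pd1 F l g \<and> C l g = pd2 F l g \<and>
            R l g = surface_rate p \<nu> lab Q \<Omega> (D l g) (C l g))
       \<and> (\<forall>S\<subseteq>\<Omega>. convex S \<longrightarrow> concave_on S (\<lambda>(l, g). F l g))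
       \<and> (\<exists>Cdot Ddot Rdot. \<forall>t\<in>T.
            ((\<lambda>s. C (lam s) (gam s)) has_real_derivative Cdot t) (at t within T) \<and>
            ((\<lambda>s. D (lam s) (gam s)) has_real_derivative Ddot t) (at t within T) \<and>
            ((\<lambda>s. R (lam s) (gam s)) has_real_derivative Rdot t) (at t within T) \<and>
            lamdot t = - \<alpha> * pd2 (pd2 F) (lam t) (gam t) \<and>
            gamdot t = \<alpha> * pd1 (pd2 F) (lam t) (gam t) \<and>
            Cdot t = 0 \<and>
            Ddot t = pd1 D (lam t) (gam t) * lamdot t + pd2 D (lam t) (gam t) * gamdot t \<and>
            Ddot t = - \<alpha> * (pd1 (pd1 F) (lam t) (gam t) * pd2 (pd2 F) (lam t) (gam t)
                             - (pd1 (pd2 F) (lam t) (gam t))\<^sup>2) \<and>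
            Ddot t = - \<alpha> * det (Hess F (lam t) (gam t)) \<and>
            Rdot t = - lam t * Ddot t \<and>
            (lam t > 0 \<and> Ddot t < 0 \<longrightarrow> Rdot t > 0) \<and>
            (det (Hess F (lam t) (gam t)) \<noteq> 0 \<longrightarrow>
               (let \<rho> = surface_rate p \<nu> lab Q \<Omega>; d = D (lam t) (gam t); c = C (lam t) (gam t) in
                  (\<lambda>(d', c'). \<rho> d' c') differentiable (at (d, c)) \<and>
                  pd1 \<rho> d c = - lam t \<and> pd2 \<rho> d c = - gam t \<and>
                  Rdot t = pd1 \<rho> d c * Ddot t + pd2 \<rho> d c * Cdot t) \<and>
               negative_definite (Hess F (lam t) (gam t)) \<and>
               (\<alpha> > 0 \<longrightarrow> Ddot t < 0 \<and> lamdot t > 0)))"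
proof -
  note Om = \<open>\<forall>(l, g)\<in>\<Omega>. is_optimal p \<nu> lab Q l g (opt l g)\<close>
  have opt: "is_optimal p \<nu> lab Q l g (opt l g)" if "(l, g) \<in> \<Omega>" for l g
    using Om that by auto
  have F: "F l g = lagrangian p \<nu> lab l g (opt l g)" if "(l, g) \<in> \<Omega>" for l g
    using free_energy_optimal[OF opt[OF that]] \<open>F = _\<close> by simp
  \<comment> \<open>The domination property is optimality at \<open>(l, g)\<close> tested against
    the model chosen at \<open>(l', g')\<close>.\<close>
  interpret supporting_planes R D C F \<Omega>
  proof
    show "F l g = R l g + l * D l g + g * C l g" if "(l, g) \<in> \<Omega>" for l g
      using F[OF that] \<open>R = _\<close> \<open>D = _\<close> \<open>C = _\<close> by (simp add: lagrangian_def)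
    show "F l g \<le> R l' g' + l * D l' g' + g * C l' g'" if "(l, g) \<in> \<Omega>" "(l', g') \<in> \<Omega>" for l g l' g'
      using F[OF that(1)] opt[OF that(1)] opt[OF that(2)] \<open>R = _\<close> \<open>D = _\<close> \<open>C = _\<close>
      by (simp add: lagrangian_def is_optimal_def)
  qed (fact \<open>open \<Omega>\<close> \<open>C2_on \<Omega> F\<close>)+
  define \<rho> where "\<rho> = surface_rate p \<nu> lab Q \<Omega>"
  have \<rho>: "\<rho> (D l g) (C l g) = R l g" if "(l, g) \<in> \<Omega>" for l g
    using surface_rate_optimal[OF that opt[OF that]] \<open>R = _\<close> \<open>D = _\<close> \<open>C = _\<close> by (simp add: \<rho>_def)

  \<comment> \<open>Derivatives along the iso-classification process\<close>
  define Ddot where "Ddot t = - \<alpha> * det (Hess F (lam t) (gam t))" for t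
  have det: "det (Hess F l g) = pd1 (pd1 F) l g * pd2 (pd2 F) l g - (pd1 (pd2 F) l g)\<^sup>2"
    if "(l, g) \<in> \<Omega>" for l g
    using second_partials(5)[OF that] by (simp add: det_2 Hess_def power2_eq_square)
  have path: "(lam t, gam t) \<in> \<Omega>" if "t \<in> T" for t using assms that by blast
  have lamdot: "lamdot t = - \<alpha> * pd2 (pd2 F) (lam t) (gam t)"
    and gamdot: "gamdot t = \<alpha> * pd1 (pd2 F) (lam t) (gam t)" if "t \<in> T" for t
    using assms that second_partials[OF path[OF that]] by auto
  have Ddot: "Ddot t = pd1 D (lam t) (gam t) * lamdot t + pd2 D (lam t) (gam t) * gamdot t" if "t \<in> T" for t
    using lamdot[OF that] gamdot[OF that] second_partials[OF path[OF that]] det[OF path[OF that]]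
    by (simp add: Ddot_def right_diff_distrib power2_eq_square)
  have dl: "(lam has_real_derivative lamdot t) (at t within T)"
    and dg: "(gam has_real_derivative gamdot t) (at t within T)" if "t \<in> T" for t
    using assms that by auto
  have dD: "((\<lambda>s. D (lam s) (gam s)) has_real_derivative Ddot t) (at t within T)" if "t \<in> T" for t
    using C1_on_chain[OF open_dom C1_D path dl dg, OF that that that] Ddot[OF that] by simp
  \<comment> \<open>The velocity is \<alpha> times the gradient of \<open>C\<close> turned by a
    right angle, hence tangent to the level sets of \<open>C\<close>.\<close>
  have dC: "((\<lambda>s. C (lam s) (gam s)) has_real_derivative 0) (at t within T)" if "t \<in> T" for t
    using C1_on_chain[OF open_dom C1_C path dl dg, OF that that that] lamdot[OF that] gamdot[OF that]
      second_partials[OF path[OF that]] by (simp add: algebra_simps)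
  have dR: "((\<lambda>s. R (lam s) (gam s)) has_real_derivative - lam t * Ddot t) (at t within T)" if "t \<in> T" for t
    using R_along_path[OF path that dl dg dD dC, OF _ that that that that] by simp

  \<comment> \<open>Points with nonsingular Hessian\<close>
  have nondegenerate:
    "((\<lambda>(d', c'). \<rho> d' c') has_derivative (\<lambda>(h, k). - l * h + - g * k)) (at (D l g, C l g))"
    "negative_definite (Hess F l g)" "det (Hess F l g) > 0" "pd2 (pd2 F) l g < 0"
    if lg: "(l, g) \<in> \<Omega>" and ne: "det (Hess F l g) \<noteq> 0" for l g
  proof -
    show "((\<lambda>(d', c'). \<rho> d' c') has_derivative (\<lambda>(h, k). - l * h + - g * k)) (at (D l g, C l g))"
      using ne det[OF lg] second_partials[OF lg]
      by (intro surface_has_derivative \<rho> lg) (simp_all add: power2_eq_square)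
    \<comment> \<open>The positive determinant will give the sign of \<open>Ddot\<close>, and the
      negative second partial in the second multiplier that of \<open>lamdot\<close>.\<close>
    note q = nonpos_quadratic_form_nondegenerate[OF Hess_nonpos[OF lg] ne[unfolded det[OF lg]]]
    show "det (Hess F l g) > 0" "pd2 (pd2 F) l g < 0" using q det[OF lg] by auto
    show "negative_definite (Hess F l g)"
      unfolding Hess_def second_partials(5)[OF lg] by (rule negative_definite_2) (rule q(4))
  qed
  have surface: "(\<lambda>(d', c'). \<rho> d' c') differentiable (at (D l g, C l g))"
    "pd1 \<rho> (D l g) (C l g) = - l" "pd2 \<rho> (D l g) (C l g) = - g"
    if "(l, g) \<in> \<Omega>" "det (Hess F l g) \<noteq> 0" for l g
    using has_derivative_pd[OF nondegenerate(1)[OF that]] nondegenerate(1)[OF that]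
    by (auto simp: differentiable_def)
  show ?thesis
    unfolding \<rho>_def[symmetric]
  proof (intro conjI;
      (rule exI[of _ "\<lambda>_. 0"], rule exI[of _ Ddot], rule exI[of _ "\<lambda>t. - lam t * Ddot t"])?;
      (intro ballI conjI)?)
    show "\<forall>S\<subseteq>\<Omega>. convex S \<longrightarrow> concave_on S (\<lambda>(l, g). F l g)" using F_concave by blast
    show "case x of (l, g) \<Rightarrow> D l g = pd1 F l g \<and> C l g = pd2 F l g \<and> R l g = \<rho> (D l g) (C l g)"
      if "x \<in> \<Omega>" for x
      using that D_eq_pd1_F C_eq_pd2_F \<rho> by auto
    fix t assume t: "t \<in> T"
    show "lam t > 0 \<and> Ddot t < 0 \<longrightarrow> - lam t * Ddot t > 0" by (simp add: mult_less_0_iff)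
    show "Ddot t = - \<alpha> * (pd1 (pd1 F) (lam t) (gam t) * pd2 (pd2 F) (lam t) (gam t)
                             - (pd1 (pd2 F) (lam t) (gam t))\<^sup>2)"
      using det[OF path[OF t]] by (simp add: Ddot_def)
    show "det (Hess F (lam t) (gam t)) \<noteq> 0 \<longrightarrow>
               (let \<rho> = \<rho>; d = D (lam t) (gam t); c = C (lam t) (gam t) in
                  (\<lambda>(d', c'). \<rho> d' c') differentiable (at (d, c)) \<and>
                  pd1 \<rho> d c = - lam t \<and> pd2 \<rho> d c = - gam t \<and>
                  - lam t * Ddot t = pd1 \<rho> d c * Ddot t + pd2 \<rho> d c * 0) \<and>
               negative_definite (Hess F (lam t) (gam t)) \<and>
               (\<alpha> > 0 \<longrightarrow> Ddot t < 0 \<and> lamdot t > 0)"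
      using surface[OF path[OF t]] nondegenerate(2-4)[OF path[OF t]] lamdot[OF t]
      by (auto simp: Let_def Ddot_def mult_less_0_iff)
  qed (use lamdot gamdot Ddot dC dD dR in \<open>auto simp: Ddot_def\<close>)
qed

end
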